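(* There exists a $(9,108)$-strategy for the GKS game; that is, in the GKS game with parameters $n=108$ and $k=9$, Alice and Bob have a strategy that wins against every behavior of Merlin.
   Context: The GKS game with parameters $n,k$ is played by Alice and Bob (a team, who may agree on a strategy beforehand but cannot communicate during play) against Merlin. A string $x\in\{0,1\}^n$ is initially empty. Merlin chooses an arbitrary ordering (permutation) of the positions $\{1,\dots,n\}$ and reveals the positions to Alice one at a time in that order. When Alice receives a position $i$ (among the first $n-1$ revealed positions), she must immediately choose the bit $x_i$, knowing only the positions revealed so far (and the bits she has already chosen). The last remaining position is filled with a bit of Merlin's choice. The completed string $x$ is then given to Bob, who (knowing only $x$) outputs a set $S$ of $k$ positions. Alice and Bob win if $S$ contains the position filled by Merlin. A winning strategy for Alice and Bob in this game (i.e. one that wins for every ordering and every choice of the last bit by Merlin) is called a $(k,n)$-strategy. The cost of the $n$-game is the minimal $k$ for which a $(k,n)$-strategy exists. *)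

theory Defs
  imports Main
begin

(* Positions are 0..n-1 (the paper's 1..n, shifted).
   An ordering chosen by Merlin is a list p with distinct p and set p = {..<n}.
   Alice's strategy A maps the sequence of positions revealed so far (ending with the
   current position) to the bit she writes there; the bits she already chose are a
   function of this sequence, so this captures all her information.
   The last position of p is filled with Merlin's bit b. *)
definition game_string :: "nat \<Rightarrow> (nat list \<Rightarrow> bool) \<Rightarrow> nat list \<Rightarrow> bool \<Rightarrow> bool list" where
  "game_string n A p b =
     map (\<lambda>i. if i = last p then b else A (takeWhile (\<lambda>j. j \<noteq> i) p @ [i])) [0..<n]"

definition gks_strategy_exists :: "nat \<Rightarrow> nat \<Rightarrow> bool" where
  "gks_strategy_exists k n \<longleftrightarrow>
     (\<exists>(A :: nat list \<Rightarrow> bool) (B :: bool list \<Rightarrow> nat set).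
        (\<forall>x. length x = n \<longrightarrow> B x \<subseteq> {..<n} \<and> card (B x) = k) \<and>
        (\<forall>p b. distinct p \<and> set p = {..<n} \<longrightarrow> last p \<in> B (game_string n A p b)))"

end

theory Submission
  imports Defs
begin

text \<open>
  Split the 108 positions into 9 blocks of 12. In each block Alice writes 0 at the first three
  positions revealed, which form a triple \<open>T\<close>, and from then on copies a codeword
  \<open>c T\<close> of a binary code of length 12 and minimum distance 3 that vanishes on \<open>T\<close>; at the last
  position of the block she writes the opposite of \<open>c T\<close>. There are 220 triples, so a
  shortened Hamming code with its 256 codewords has room for an injective \<open>c\<close>. If Bob sees a
  block equal to some \<open>c T\<close>, Merlin's position lies in it and outside \<open>T\<close>, which leaves 9
  candidates. Otherwise every block differs from a codeword in exactly one position, its last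
  one, and Bob collects these 9 positions.
\<close>

section \<open>Playing on several blocks\<close>

text \<open>The words in \<open>F\<close> reveal that Merlin has filled the last position.\<close>

definition block_strategy ::
    "nat \<Rightarrow> nat \<Rightarrow> (nat list \<Rightarrow> bool) \<Rightarrow> (bool list \<Rightarrow> nat set) \<Rightarrow> bool list set \<Rightarrow> bool" where
  "block_strategy k m A B F \<longleftrightarrow>
     (\<forall>w. B w \<subseteq> {..<m} \<and> card (B w) \<le> (if w \<in> F then k else 1)) \<and>
     (\<forall>p. distinct p \<and> set p = {..<m} \<longrightarrow>
        game_string m A p (A p) \<notin> F \<and> (\<forall>b. last p \<in> B (game_string m A p b)))"

lemma takeWhile_neq_append_last:
  assumes "distinct p" "p \<noteq> []"
  shows "takeWhile (\<lambda>j. j \<noteq> last p) p @ [last p] = p"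
proof -
  obtain q x where p: "p = q @ [x]"
    using assms(2) by (cases p rule: rev_cases) auto
  then have "x \<notin> set q"
    using assms(1) by auto
  then have "takeWhile (\<lambda>j. j \<noteq> x) (q @ [x]) = q @ takeWhile (\<lambda>j. j \<noteq> x) [x]"
    by (intro takeWhile_append2) auto
  then show ?thesis
    by (simp add: p)
qed

lemma takeWhile_neq_filter:
  assumes "P y"
  shows "filter P (takeWhile (\<lambda>j. j \<noteq> y) p) = takeWhile (\<lambda>j. j \<noteq> y) (filter P p)"
  using assms by (induction p) auto

lemma takeWhile_neq_map:
  assumes "inj_on f (insert y (set p))"
  shows "map f (takeWhile (\<lambda>j. j \<noteq> y) p) = takeWhile (\<lambda>j. j \<noteq> f y) (map f p)"
  using assms
proof (induction p)
  case (Cons x p)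
  from Cons.prems have "inj_on f (insert y (set p))"
    by (rule inj_on_subset) auto
  moreover from Cons.prems have "f x = f y \<longleftrightarrow> x = y"
    by (rule inj_on_eq_iff) auto
  ultimately show ?case
    using Cons.IH by simp
qed simp

text \<open>Block \<open>q\<close> consists of the positions \<open>q * m + i\<close> with
  \<open>i < m\<close>, so \<open>div\<close> gives the block and \<open>mod\<close> the place
  inside it.\<close>

definition block_order :: "nat \<Rightarrow> nat \<Rightarrow> nat list \<Rightarrow> nat list" where
  "block_order m q p = map (\<lambda>y. y mod m) (filter (\<lambda>y. y div m = q) p)"

lemma inj_on_mod_block: "inj_on (\<lambda>y. y mod m) {y. y div m = (q::nat)}"
proof (rule inj_onI)
  fix x y assume "x \<in> {y. y div m = q}" "y \<in> {y. y div m = q}" and mod: "x mod m = y mod m"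
  then have div: "x div m = q" "y div m = q"
    by (simp_all only: mem_Collect_eq)
  have "x = x div m * m + x mod m"
    by (rule div_mult_mod_eq[symmetric])
  also have "\<dots> = y div m * m + y mod m"
    by (simp only: div mod)
  also have "\<dots> = y"
    by (rule div_mult_mod_eq)
  finally show "x = y" .
qed

lemma distinct_block_order:
  assumes "distinct p"
  shows "distinct (block_order m q p)"
proof -
  have "inj_on (\<lambda>y. y mod m) (set (filter (\<lambda>y. y div m = q) p))"
    by (rule inj_on_subset[OF inj_on_mod_block[of m q]]) auto
  then show ?thesis
    using assms by (simp add: block_order_def distinct_map)
qed

lemma block_position_less:
  assumes "q < k" "i < (m::nat)"
  shows "q * m + i < k * m"
proof -
  have "q * m + i < Suc q * m" using assms(2) by simp
  also have "\<dots> \<le> k * m" using assms(1) by (intro mult_right_mono) auto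
  finally show ?thesis .
qed

lemma set_block_order:
  assumes "set p = {..<k * m}" "q < k" "0 < m"
  shows "set (block_order m q p) = {..<m}"
proof (intro equalityI subsetI)
  fix i assume i: "i \<in> {..<m}"
  then have "q * m + i \<in> set (filter (\<lambda>y. y div m = q) p)"
    using assms block_position_less[of q k i m] by simp
  moreover have "(q * m + i) mod m = i"
    using i by simp
  ultimately show "i \<in> set (block_order m q p)"
    unfolding block_order_def set_map by (metis (no_types, lifting) imageI)
next
  fix i assume "i \<in> set (block_order m q p)"
  then show "i \<in> {..<m}"
    using \<open>0 < m\<close> unfolding block_order_def by (auto simp only: set_map lessThan_iff mod_less_divisor)
qed

definition block_word :: "nat \<Rightarrow> nat \<Rightarrow> bool list \<Rightarrow> bool list" where
  "block_word m q x = map (\<lambda>i. x ! (q * m + i)) [0..<m]"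

text \<open>The revealed sequence ends with the current position, so \<open>last p div m\<close> is
  the block being played; what happened in the other blocks is forgotten.\<close>

definition lift_strategy :: "nat \<Rightarrow> (nat list \<Rightarrow> bool) \<Rightarrow> nat list \<Rightarrow> bool" where
  "lift_strategy m A p = A (block_order m (last p div m) p)"

text \<open>Every block is a play of the small game: taking the prefix before a position commutes
  with restriction to its block. Merlin's bit enters only one block; any other block looks as if
  Merlin had copied Alice's own answer at its last position.\<close>

lemma block_word_game_string:
  assumes p: "distinct p" "set p = {..<k * m}" and "q < k" "0 < m"
  shows "block_word m q (game_string (k * m) (lift_strategy m A) p b) =
    game_string m A (block_order m q p)
      (if last p div m = q then b else A (block_order m q p))"
    (is "_ = game_string m A ?p ?b")
proof -
  have p': "distinct ?p" "set ?p = {..<m}"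
    using assms distinct_block_order set_block_order by blast+
  have "?p \<noteq> []"
    using p'(2) \<open>0 < m\<close> by (metis empty_iff empty_set lessThan_iff)
  have p_ne: "p \<noteq> []"
    using \<open>?p \<noteq> []\<close> by (auto simp: block_order_def)
  have last_block: "last ?p = last p mod m" if "last p div m = q"
    using that p_ne by (cases p rule: rev_cases) (auto simp: block_order_def)
  have "game_string (k * m) (lift_strategy m A) p b ! (q * m + i) =
      game_string m A ?p ?b ! i" if i: "i < m" for i
  proof -
    let ?y = "q * m + i"
    have y: "?y div m = q" "?y mod m = i"
      using i by auto
    have y_less: "?y < k * m"
      using \<open>q < k\<close> i by (rule block_position_less)
    have "lift_strategy m A (takeWhile (\<lambda>j. j \<noteq> ?y) p @ [?y]) =
        A (block_order m q (takeWhile (\<lambda>j. j \<noteq> ?y) p) @ [i])"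
      using i by (simp add: lift_strategy_def block_order_def)
    also have "block_order m q (takeWhile (\<lambda>j. j \<noteq> ?y) p) = takeWhile (\<lambda>j. j \<noteq> i) ?p"
    proof -
      have "inj_on (\<lambda>y. y mod m) (insert ?y (set (filter (\<lambda>y. y div m = q) p)))"
        using y by (intro inj_on_subset[OF inj_on_mod_block[of m q]]) auto
      from takeWhile_neq_map[OF this] show ?thesis
        unfolding block_order_def y by (simp only: takeWhile_neq_filter[where P = "\<lambda>y. y div m = q", OF y(1)])
    qed
    finally have lift: "lift_strategy m A (takeWhile (\<lambda>j. j \<noteq> ?y) p @ [?y]) =
      A (takeWhile (\<lambda>j. j \<noteq> i) ?p @ [i])" .
    show ?thesis
    proof (cases "last p div m = q")
      case True
      then have "?y = last p \<longleftrightarrow> i = last ?p"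
        using last_block y div_mult_mod_eq[of "last p" m] by metis
      then show ?thesis
        using True y_less i lift by (simp add: game_string_def)
    next
      case False
      then have "?y \<noteq> last p" using y by auto
      \<comment> \<open>Here Alice herself fills the last position of the block, after seeing the
        block's entire order.\<close>
      moreover have "A (takeWhile (\<lambda>j. j \<noteq> i) ?p @ [i]) = A ?p" if "i = last ?p"
        using that takeWhile_neq_append_last[OF p'(1) \<open>?p \<noteq> []\<close>] by simp
      ultimately show ?thesis
        using False y_less i lift by (auto simp: game_string_def)
    qed
  qed
  moreover have "length (game_string m A ?p ?b) = m"
    by (simp add: game_string_def)
  ultimately show ?thesis
    by (intro nth_equalityI) (simp_all add: block_word_def)
qed

text \<open>Only Merlin's block can carry a word of \<open>F\<close>. If it does, its at most
  \<open>k\<close> candidates suffice; otherwise each of the \<open>k\<close> blocks contributes at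
  most one. Thus \<open>k\<close> is both the bound inside a flagged block and the number of
  blocks.\<close>

lemma gks_strategy_exists_blocks:
  assumes A: "block_strategy k m A B F" and "0 < k" "0 < m"
  shows "gks_strategy_exists k (k * m)"
proof -
  define shift :: "nat \<Rightarrow> nat set \<Rightarrow> nat set" where "shift q X = (+) (q * m) ` X" for q X
  define flagged where "flagged x = {q. q < k \<and> block_word m q x \<in> F}" for x
  \<comment> \<open>\<open>Min\<close> is an arbitrary choice: in actual plays at most one block is
    flagged, but the size bound must hold for every string.\<close>
  define cand where "cand x = (if flagged x = {}
      then \<Union>q<k. shift q (B (block_word m q x))
      else let q = Min (flagged x) in shift q (B (block_word m q x)))" for x
  have B: "B w \<subseteq> {..<m}" "card (B w) \<le> (if w \<in> F then k else 1)" for w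
    using A by (auto simp: block_strategy_def)
  have Min_flagged: "Min (flagged x) \<in> flagged x" if "flagged x \<noteq> {}" for x
    using that by (intro Min_in) (auto simp: flagged_def)
  have shift_sub: "shift q (B w) \<subseteq> {..<k * m}" if "q < k" for q w
  proof
    fix y assume "y \<in> shift q (B w)"
    then obtain i where "y = q * m + i" "i < m"
      using B(1)[of w] by (auto simp: shift_def)
    then show "y \<in> {..<k * m}"
      using block_position_less[OF that] by simp
  qed
  have card_shift: "card (shift q X) = card X" for q X
    by (simp add: shift_def card_image)
  have cand_sub: "cand x \<subseteq> {..<k * m}" for x
    using shift_sub Min_flagged[of x] by (auto simp: cand_def flagged_def Let_def)
  have card_cand: "card (cand x) \<le> k" for x
  proof (cases "flagged x = {}")
    case True
    have "card (\<Union>q<k. shift q (B (block_word m q x))) \<le>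
        (\<Sum>q<k. card (shift q (B (block_word m q x))))"
      by (intro card_UN_le) auto
    also have "\<dots> \<le> (\<Sum>q<k. 1)"
    proof (intro sum_mono)
      fix q assume "q \<in> {..<k}"
      then show "card (shift q (B (block_word m q x))) \<le> 1"
        using B(2)[of "block_word m q x"] True by (auto simp: card_shift flagged_def)
    qed
    finally show ?thesis using True by (simp add: cand_def)
  next
    case False
    then show ?thesis
      using Min_flagged[of x] B(2)[of "block_word m (Min (flagged x)) x"]
      by (auto simp: cand_def flagged_def Let_def card_shift)
  qed
  \<comment> \<open>Bob must name exactly \<open>k\<close> positions, so the candidates are
    padded.\<close>
  have "\<exists>S. cand x \<subseteq> S \<and> S \<subseteq> {..<k * m} \<and> card S = k" for x
  proof -
    have "k \<le> card {..<k * m}" using \<open>0 < m\<close> by simp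
    from exists_subset_between[OF card_cand this cand_sub]
    show ?thesis by auto
  qed
  then obtain S where S: "cand x \<subseteq> S x" "S x \<subseteq> {..<k * m}" "card (S x) = k" for x
    by metis
  have win: "last p \<in> cand (game_string (k * m) (lift_strategy m A) p b)"
    if p: "distinct p" "set p = {..<k * m}" for p b
  proof -
    let ?x = "game_string (k * m) (lift_strategy m A) p b"
    let ?q = "last p div m"
    have "p \<noteq> []" using p(2) \<open>0 < k\<close> \<open>0 < m\<close>
      by (metis empty_iff empty_set lessThan_iff nat_0_less_mult_iff)
    then have "last p < k * m" using p(2) last_in_set by blast
    then have q: "?q < k" by (simp add: less_mult_imp_div_less)
    have order: "distinct (block_order m r p)" "set (block_order m r p) = {..<m}" if "r < k" for r
      using that p \<open>0 < m\<close> distinct_block_order set_block_order by blast+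
    have "last (block_order m ?q p) \<in> B (block_word m ?q ?x)"
      using A order[OF q] block_word_game_string[OF p q \<open>0 < m\<close>, of A b]
      by (simp add: block_strategy_def)
    moreover have "last (block_order m ?q p) = last p mod m"
      using \<open>p \<noteq> []\<close> by (cases p rule: rev_cases) (auto simp: block_order_def)
    ultimately have mem: "last p \<in> shift ?q (B (block_word m ?q ?x))"
      by (auto simp: shift_def intro!: image_eqI[of _ _ "last p mod m"])
    have "block_word m r ?x \<notin> F" if "r < k" "r \<noteq> ?q" for r
      using A order[OF that(1)] block_word_game_string[OF p that(1) \<open>0 < m\<close>, of A b] that(2)
      by (auto simp: block_strategy_def)
    then have "flagged ?x \<subseteq> {?q}"
      by (auto simp: flagged_def)
    then have "flagged ?x = {} \<or> flagged ?x = {?q}" by blast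
    then show ?thesis
      using mem q by (auto simp: cand_def Let_def)
  qed
  show ?thesis
    unfolding gks_strategy_exists_def
  proof (intro exI[of _ "lift_strategy m A"] exI[of _ S] conjI allI impI)
    fix p b assume "distinct p \<and> set p = {..<k * m}"
    then show "last p \<in> S (game_string (k * m) (lift_strategy m A) p b)"
      using win S(1) by (meson subsetD)
  qed (use S in simp_all)
qed

section \<open>Words with a syndrome\<close>

text \<open>The columns of the parity-check matrix are the binary expansions of \<open>j, j + 1, j + 2, \<dots>\<close>.\<close>

fun syndrome :: "nat \<Rightarrow> bool list \<Rightarrow> nat" where
  "syndrome j [] = 0"
| "syndrome j (b # w) = xor (if b then j else 0) (syndrome (Suc j) w)"

text \<open>Flipping one bit adds or removes one column in the xor; hence the syndrome of a codeword
  with a single error reveals the position of the error.\<close>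

lemma syndrome_flip:
  "i < length w \<Longrightarrow> syndrome j (w[i := \<not> w ! i]) = xor (j + i) (syndrome j w)"
proof (induction w arbitrary: i j)
  case (Cons b w)
  then show ?case
    by (cases i) (auto simp: xor.left_commute simp flip: xor.assoc)
qed simp

text \<open>From a codeword Bob recovers the set \<open>T\<close> of the first \<open>d\<close>
  positions by injectivity and excludes it; from any other word that occurs he decodes the single
  error, which sits at the last position.\<close>

lemma block_strategy_if_codewords:
  fixes c :: "nat set \<Rightarrow> bool list" and m d :: nat
  defines "Ts \<equiv> {T. T \<subseteq> {..<m} \<and> card T = d}"
  assumes "d < m" and inj: "inj_on c Ts"
    and len: "\<And>T. T \<in> Ts \<Longrightarrow> length (c T) = m"
    and code: "\<And>T. T \<in> Ts \<Longrightarrow> syndrome 1 (c T) = 0"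
    and zero: "\<And>T i. T \<in> Ts \<Longrightarrow> i \<in> T \<Longrightarrow> \<not> c T ! i"
  shows "\<exists>A B. block_strategy (m - d) m A B (c ` Ts)"
proof -
  \<comment> \<open>The test \<open>length p = m\<close> recognises the last position of the block,
    where Alice deviates from the codeword.\<close>
  define A where "A p = (if length p \<le> d then False
      else (c (set (take d p)) ! last p) \<noteq> (length p = m))" for p
  \<comment> \<open>Columns are numbered from 1 and positions from 0, hence the \<open>- 1\<close>.
    The intersection keeps the answer inside the block for words that no play produces.\<close>
  define B where "B w = (if w \<in> c ` Ts then {..<m} - inv_into Ts c w
      else {syndrome 1 w - 1} \<inter> {..<m})" for w
  have "B w \<subseteq> {..<m} \<and> card (B w) \<le> (if w \<in> c ` Ts then m - d else 1)" for w
  proof (cases "w \<in> c ` Ts")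
    case True
    then have "inv_into Ts c w \<in> Ts" by (rule inv_into_into)
    with True show ?thesis
      by (auto simp: B_def Ts_def card_Diff_subset finite_subset)
  next
    case False
    have "card ({syndrome 1 w - 1} \<inter> {..<m}) \<le> card {syndrome 1 w - 1}"
      by (intro card_mono) auto
    with False show ?thesis by (auto simp: B_def)
  qed
  moreover have "game_string m A p (A p) \<notin> c ` Ts \<and> last p \<in> B (game_string m A p b)"
    if p: "distinct p" "set p = {..<m}" for p b
  proof -
    let ?T = "set (take d p)"
    let ?l = "last p"
    have len_p: "length p = m"
      using p distinct_card by fastforce
    then have "p \<noteq> []" using \<open>d < m\<close> by auto
    have T: "?T \<in> Ts"
      using p len_p \<open>d < m\<close> by (auto simp: Ts_def distinct_card dest: in_set_takeD)
    have l: "?l < m" using \<open>p \<noteq> []\<close> p(2) last_in_set by blast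
    have l_notin: "?l \<notin> ?T"
    proof -
      have "?l = last (drop d p)" "drop d p \<noteq> []" using len_p \<open>d < m\<close> by auto
      then have "?l \<in> set (drop d p)" by (metis last_in_set)
      then show ?thesis
        using p(1) set_take_disj_set_drop_if_distinct[of p d d] by auto
    qed
    \<comment> \<open>Alice writes \<open>False\<close> before the first \<open>d\<close> positions
      are all known, which agrees with the codeword because it vanishes on them; afterwards every
      prefix determines \<open>?T\<close>.\<close>
    have A_follows: "A (takeWhile (\<lambda>j. j \<noteq> i) p @ [i]) = c ?T ! i" if i: "i < m" "i \<noteq> ?l" for i
    proof -
      from i p(2) have "i \<in> set p" by auto
      then obtain u v where uv: "p = u @ i # v" "i \<notin> set u"
        by (meson split_list_first)
      have "v \<noteq> []" using i uv by auto
      have "takeWhile (\<lambda>j. j \<noteq> i) p = u" using uv by (auto simp: takeWhile_append)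
      moreover have "length u + 1 < m" using uv \<open>v \<noteq> []\<close> len_p by auto
      moreover have "i \<in> ?T" if "length u < d"
        using that uv by (auto simp: take_Cons')
      moreover have "take d (u @ [i]) = take d p" if "d \<le> length u"
        using that uv by simp
      ultimately show ?thesis
        using zero[OF T] by (auto simp: A_def)
    qed
    have game: "game_string m A p b = (c ?T)[?l := b]" for b
      by (rule nth_equalityI)
        (use len[OF T] A_follows in \<open>auto simp: game_string_def nth_list_update\<close>)
    \<comment> \<open>Starting the columns at 1 makes this syndrome nonzero, so the altered word
      cannot be a codeword.\<close>
    have flip: "syndrome 1 ((c ?T)[?l := \<not> c ?T ! ?l]) = Suc ?l"
      using syndrome_flip[of ?l "c ?T" 1] len[OF T] code[OF T] l by simp
    then have flip_notin: "(c ?T)[?l := \<not> c ?T ! ?l] \<notin> c ` Ts"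
      using code by fastforce
    have "A p = (\<not> c ?T ! ?l)"
      using len_p \<open>d < m\<close> by (simp add: A_def)
    moreover have "?l \<in> B ((c ?T)[?l := b])"
    proof (cases "b = c ?T ! ?l")
      case True
      then show ?thesis
        using T l l_notin inj by (simp add: B_def)
    next
      case False
      then have "b = (\<not> c ?T ! ?l)" by auto
      then show ?thesis
        using flip flip_notin l by (simp add: B_def)
    qed
    ultimately show ?thesis
      using flip_notin by (simp add: game)
  qed
  ultimately show ?thesis
    unfolding block_strategy_def by blast
qed

section \<open>Codewords for the triples\<close>

text \<open>
  The codewords in \<open>triple_codes\<close>, written in binary, are assigned greedily: each triple in
  turn receives the largest unused number whose word has syndrome 0 and vanishes on the triple.
\<close>

definition triples :: "nat list list" where
  "triples = [[a, b, c]. c \<leftarrow> [0..<12], b \<leftarrow> [0..<c], a \<leftarrow> [0..<b]]"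

definition triple_codes :: "nat list" where
  "triple_codes = [
    3952, 3908, 3874, 3857, 3848, 3816, 3945, 3778, 3877, 3907, 3804, 3930, 3728, 3862,
    3781, 3521, 3726, 3721, 3466, 3526, 3900, 3770, 3513, 3748, 3488, 3747, 3110, 3469,
    3105, 3495, 3476, 3093, 3475, 3735, 3855, 3188, 3178, 3161, 3136, 2677, 3187, 3950,
    3181, 3083, 3143, 3166, 3933, 3090, 2630, 3084, 3128, 2617, 3899, 2599, 2592, 2580,
    2668, 2674, 3825, 3830, 2625, 2579, 2570, 2573, 2667, 2244, 2648, 2269, 3803, 2243,
    2191, 2622, 3773, 2235, 2213, 2210, 2198, 1662, 1657, 1632, 1639, 1613, 2655, 3135,
    3564, 3570, 3544, 2422, 3573, 2417, 2408, 2373, 3563, 2370, 2396, 2320, 2395, 2327,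
    2318, 3518, 2365, 2362, 2340, 2339, 2313, 1402, 1405, 1379, 1380, 2415, 1367, 1334,
    2288, 2281, 2266, 2295, 2286, 2193, 2236, 127, 3060, 3050, 3033, 3008, 2977, 3059,
    2982, 3053, 2955, 3015, 3038, 2965, 2962, 854, 2956, 3000, 2184, 816, 823, 814, 797,
    892, 869, 891, 866, 847, 849, 809, 762, 765, 739, 740, 718, 727, 694, 120, 510, 505,
    480, 487, 461, 468, 437, 102, 97, 2040, 2002, 2017, 2022, 2005, 1971, 1996, 1965,
    1995, 1927, 1950, 1945, 1920, 1620, 1610, 1972, 1589, 1962, 1586, 1580, 1567, 1560,
    1537, 1619, 1542, 1579, 1360, 1329, 1276, 1253, 1275, 1250, 1231, 1238, 1207, 85,
    1358, 1353, 1320, 1285, 1327, 1308, 1307, 1282, 1233, 840, 772, 794, 771, 713, 720,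
    689, 82, 687, 467]"

definition word_of :: "nat \<Rightarrow> bool list" where
  "word_of n = map (bit n) [0..<12]"

lemma distinct_triple_codes: "distinct triple_codes"
  by (simp add: triple_codes_def)

lemma upt_12: "[0..<12] = [0, 1, 2, 3, 4, 5, 6, 7, 8, 9, 10, 11 :: nat]"
  by (simp add: upt_rec)

text \<open>A finite check by evaluation. Stating it with \<open>list_all2\<close> also yields that
  both lists have the same length.\<close>

lemma triple_codes_correct:
  "list_all2 (\<lambda>t n. n < 2 ^ 12 \<and> syndrome 1 (word_of n) = 0 \<and> (\<forall>i\<in>set t. \<not> bit n i))
    triples triple_codes"
  by (simp add: triples_def triple_codes_def word_of_def upt_12 upt_rec bit_0
      flip: numeral_2_eq_2)

lemma inj_on_word_of: "inj_on word_of {..<2 ^ 12}"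
proof (rule inj_onI)
  fix a b :: nat
  assume ab: "a \<in> {..<2 ^ 12}" "b \<in> {..<2 ^ 12}" and "word_of a = word_of b"
  then have "\<forall>i\<in>set [0..<12]. bit a i = bit b i"
    unfolding word_of_def map_eq_conv by blast
  then have "bit a i = bit b i" if "i < 12" for i
    using that unfolding set_upt by (meson atLeastLessThan_iff le0)
  then have "take_bit 12 a = take_bit 12 b"
    by (intro bit_eqI) (metis bit_take_bit_iff)
  moreover have "take_bit 12 a = a" "take_bit 12 b = b"
    using ab by (auto intro!: take_bit_nat_eq_self)
  ultimately show "a = b" by metis
qed

text \<open>Sorting \<open>T\<close> gives \<open>[a, b, c]\<close> with \<open>a < b\<close> and
  \<open>b < c\<close>, the form in which \<open>triples\<close> enumerates the 3-element
  sets.\<close>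

lemma triple_in_triples:
  assumes "T \<subseteq> {..<12}" "card T = 3"
  shows "\<exists>t \<in> set triples. set t = T"
proof -
  have "finite T" using assms(1) finite_subset by blast
  with assms(2) obtain t where t: "set t = T" "sorted_wrt (<) t" "length t = 3"
    by (metis sorted_list_of_set.length_sorted_key_list_of_set
        sorted_list_of_set.set_sorted_key_list_of_set strict_sorted_list_of_set)
  then obtain a b c where abc: "t = [a, b, c]"
    by (auto simp: numeral_3_eq_3 length_Suc_conv)
  have "a < b" "b < c" using t(2) by (simp_all add: abc)
  moreover have "c < 12" using t(1) assms(1) unfolding abc by auto
  ultimately have "a \<in> set [0..<b]" "b \<in> set [0..<c]" "c \<in> set [0..<12]"
    unfolding set_upt by simp_all
  then have "[a, b, c] \<in> set triples"
    unfolding triples_def set_concat set_map UN_iff bex_simps image_iff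
    by (intro bexI[of _ c] bexI[of _ b] bexI[of _ a] refl)
  with t(1) abc show ?thesis by blast
qed

text \<open>Each set goes to the code at its index in \<open>triples\<close>. Injectivity combines
  three facts: 12 bits determine a number below \<open>2 ^ 12\<close>, the codes are distinct, and
  an index determines its triple.\<close>

lemma exists_codewords:
  defines "Ts \<equiv> {T. T \<subseteq> {..<12} \<and> card T = 3}"
  shows "\<exists>c. inj_on c Ts \<and>
    (\<forall>T\<in>Ts. length (c T) = 12 \<and> syndrome 1 (c T) = 0 \<and> (\<forall>i\<in>T. \<not> c T ! i))"
proof -
  have "\<exists>k. k < length triples \<and> set (triples ! k) = T" if "T \<in> Ts" for T
  proof -
    have "T \<subseteq> {..<12}" "card T = 3"
      using that by (simp_all add: Ts_def)
    from triple_in_triples[OF this] obtain t where "t \<in> set triples" "set t = T"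
      by (elim bexE)
    then show ?thesis
      unfolding in_set_conv_nth by blast
  qed
  then have "\<forall>T\<in>Ts. \<exists>k. k < length triples \<and> set (triples ! k) = T"
    by blast
  then obtain k where k: "\<forall>T\<in>Ts. k T < length triples \<and> set (triples ! k T) = T"
    by (rule bchoice[THEN exE])
  define c where "c T = word_of (triple_codes ! k T)" for T
  have nth: "triple_codes ! k T < 2 ^ 12 \<and> syndrome 1 (c T) = 0 \<and> (\<forall>i\<in>T. \<not> c T ! i)"
    if "T \<in> Ts" for T
  proof -
    have "c T ! i = bit (triple_codes ! k T) i" if "i \<in> T" for i
      using that \<open>T \<in> Ts\<close> unfolding c_def word_of_def by (subst nth_map_upt) (auto simp: Ts_def)
    then show ?thesis
      using list_all2_nthD[OF triple_codes_correct, of "k T"] k that by (simp add: c_def)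
  qed
  have "inj_on c Ts"
  proof (rule inj_onI)
    fix T U
    assume T: "T \<in> Ts" and U: "U \<in> Ts" and "c T = c U"
    then have "triple_codes ! k T = triple_codes ! k U"
      using nth[OF T] nth[OF U] by (intro inj_onD[OF inj_on_word_of]) (simp_all add: c_def)
    then have "k T = k U"
      using distinct_triple_codes k T U list_all2_lengthD[OF triple_codes_correct]
      by (simp add: nth_eq_iff_index_eq)
    then show "T = U" using k T U by metis
  qed
  moreover have "length (c T) = 12" for T
    by (simp add: c_def word_of_def)
  ultimately show ?thesis
    using nth by blast
qed

theorem theorem2:
  shows "gks_strategy_exists 9 108"
proof -
  let ?Ts = "{T. T \<subseteq> {..<12} \<and> card T = 3}"
  from exists_codewords obtain c where "inj_on c ?Ts"
    "\<forall>T\<in>?Ts. length (c T) = 12 \<and> syndrome 1 (c T) = 0 \<and> (\<forall>i\<in>T. \<not> c T ! i)"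
    by (elim exE conjE)
  then have "\<exists>A B. block_strategy (12 - 3) 12 A B (c ` ?Ts)"
    by (intro block_strategy_if_codewords) simp_all
  then obtain A B where "block_strategy 9 12 A B (c ` ?Ts)"
    by auto
  \<comment> \<open>Nine blocks of length 12 give \<open>9 * 12 = 108\<close>.\<close>
  from gks_strategy_exists_blocks[OF this] show ?thesis
    by simp
qed

end
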